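(* If the stage cost is linear, i.e. $g(x)=\beta x$ for all $x\in[0,B]$ for some constant $\beta>0$, then the myopic policy $$\mu^*(s,w)=\min\{s,w\},\qquad (s,w)\in[0,\bar s]\times[0,B],$$ is optimal, i.e. $\mu^*\in\Pi$ and $C_{\mu^*}(s)=C(s)=\min_{\mu\in\Pi}C_\mu(s)$ for all $s\in[0,\bar s]$.
   Context: Model. Fix constants $r>0$ (storage ramp rate), $Q>0$ (Poisson arrival rate), $\theta>0$ (discount rate), $\bar s\in(0,\infty)$ (storage capacity), $B\in(0,\infty)$. Shocks arrive at the arrival times $0<t_1<t_2<\cdots$ of a Poisson process of rate $Q$; the shock sizes $W_1,W_2,\dots$ are i.i.d. with a distribution $f_W$ supported in $[0,B]$ and independent of the arrival times; $W$ denotes a generic random variable with distribution $f_W$. A (stationary Markov) policy is a measurable function $\mu:[0,\bar s]\times[0,B]\to\mathbb R$ with $0\le\mu(s,w)\le\min\{s,w\}$; the set of all policies is $\Pi$. Under policy $\mu$ from initial state $s_0=s\in[0,\bar s]$, the storage level $s_t\in[0,\bar s]$ increases at rate $r$ between arrivals until it reaches $\bar s$, where it stays until the next arrival, and at each arrival time $t_k$ it jumps down: $s_{t_k}=s_{t_k^-}-\mu(s_{t_k^-},W_k)$. The stage cost $g:[0,B]\to\mathbb R$ is bounded, strictly increasing, continuously differentiable, with $g(0)=0$ and $\mathbf E[g(W)]>0$. The cost of policy $\mu$ is $$C_\mu(s)=\mathbf E\Big[\sum_{k=1}^\infty e^{-\theta t_k}\,g\big(W_k-\mu(s_{t_k^-},W_k)\big)\,\Big|\,s_0=s\Big],$$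 and the value function is $C(s)=\min_{\mu\in\Pi}C_\mu(s)$, $0\le s\le\bar s$. *)

theory Defs
  imports "HOL-Probability.Probability"
begin

text \<open>
  Arrivals and shocks are indexed from 0: \<open>T k\<close> and \<open>W k\<close> are the \<open>(k+1)\<close>-st arrival time and
  shock size, so that \<open>T 0\<close> is the waiting time until the first arrival.
\<close>

fun interarrival :: "(nat \<Rightarrow> 'a \<Rightarrow> real) \<Rightarrow> nat \<Rightarrow> 'a \<Rightarrow> real" where
  "interarrival T 0 \<omega> = T 0 \<omega>"
| "interarrival T (Suc k) \<omega> = T (Suc k) \<omega> - T k \<omega>"

text \<open>
  The Poisson process is given by i.i.d. exponential interarrival times. The range conditions on
  \<open>T\<close> and \<open>W\<close> are imposed surely rather than almost surely, so that \<open>g\<close> and the policies are only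
  ever evaluated on their mathematical domains. For the same reason \<open>E[g(W)]\<close> is written as an
  integral over \<open>{0..B}\<close>.
\<close>

locale storage_model = prob_space M
  for M :: "'a measure" +
  fixes r Q \<theta> sbar B :: real
    and fW :: "real measure"
    and T W :: "nat \<Rightarrow> 'a \<Rightarrow> real"
    and g :: "real \<Rightarrow> real"
  assumes r_pos: "r > 0" and Q_pos: "Q > 0" and theta_pos: "\<theta> > 0"
    and sbar_pos: "sbar > 0" and B_pos: "B > 0"
    and first_arrival_pos: "\<And>\<omega>. \<omega> \<in> space M \<Longrightarrow> 0 < T 0 \<omega>"
    and arrivals_increasing: "\<And>\<omega> k. \<omega> \<in> space M \<Longrightarrow> T k \<omega> < T (Suc k) \<omega>"
    and interarrivals_indep: "indep_vars (\<lambda>_. borel) (interarrival T) UNIV"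
    and interarrivals_exponential:
      "\<And>k. distributed M lborel (interarrival T k) (\<lambda>x. ennreal (exponential_density Q x))"
    and shocks_range: "\<And>\<omega> k. \<omega> \<in> space M \<Longrightarrow> W k \<omega> \<in> {0..B}"
    and shocks_indep: "indep_vars (\<lambda>_. borel) W UNIV"
    and shocks_distr: "\<And>k. distr M borel (W k) = fW"
    and shocks_arrivals_indep:
      "indep_var (PiM UNIV (\<lambda>_. borel)) (\<lambda>\<omega> k. T k \<omega>) (PiM UNIV (\<lambda>_. borel)) (\<lambda>\<omega> k. W k \<omega>)"
    and g_bounded: "bounded (g ` {0..B})"
    and g_strict_mono: "strict_mono_on {0..B} g"
    and g_C1: "\<exists>g'. continuous_on {0..B} g' \<and>
      (\<forall>x\<in>{0..B}. (g has_real_derivative g' x) (at x within {0..B}))"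
    and g_zero: "g 0 = 0"
    and g_mean_pos: "(LINT w:{0..B}|fW. g w) > 0"

definition policies :: "real \<Rightarrow> real \<Rightarrow> (real \<Rightarrow> real \<Rightarrow> real) set" where
  "policies sbar B =
    {\<mu>. (\<lambda>(s, w). \<mu> s w) \<in> borel_measurable (restrict_space borel ({0..sbar} \<times> {0..B})) \<and>
         (\<forall>s\<in>{0..sbar}. \<forall>w\<in>{0..B}. 0 \<le> \<mu> s w \<and> \<mu> s w \<le> min s w)}"

text \<open>
  \<open>pre_level \<dots> s k \<omega>\<close> is the storage level immediately before arrival \<open>k\<close> (the left limit of the
  trajectory), starting from the level \<open>s\<close> at time 0; between arrivals the level grows at rate \<open>r\<close>
  and is capped at \<open>sbar\<close>.
\<close>

fun pre_level :: "real \<Rightarrow> real \<Rightarrow> (nat \<Rightarrow> 'a \<Rightarrow> real) \<Rightarrow> (nat \<Rightarrow> 'a \<Rightarrow> real) \<Rightarrow>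
    (real \<Rightarrow> real \<Rightarrow> real) \<Rightarrow> real \<Rightarrow> nat \<Rightarrow> 'a \<Rightarrow> real" where
  "pre_level r sbar T W \<mu> s 0 \<omega> = min sbar (s + r * interarrival T 0 \<omega>)"
| "pre_level r sbar T W \<mu> s (Suc k) \<omega> =
    min sbar (pre_level r sbar T W \<mu> s k \<omega> - \<mu> (pre_level r sbar T W \<mu> s k \<omega>) (W k \<omega>)
      + r * interarrival T (Suc k) \<omega>)"

definition policy_cost :: "'a measure \<Rightarrow> real \<Rightarrow> real \<Rightarrow> real \<Rightarrow> (nat \<Rightarrow> 'a \<Rightarrow> real) \<Rightarrow>
    (nat \<Rightarrow> 'a \<Rightarrow> real) \<Rightarrow> (real \<Rightarrow> real) \<Rightarrow> (real \<Rightarrow> real \<Rightarrow> real) \<Rightarrow> real \<Rightarrow> real" where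
  "policy_cost M r \<theta> sbar T W g \<mu> s =
    (\<integral>\<omega>. (\<Sum>k. exp (- \<theta> * T k \<omega>) *
      g (W k \<omega> - \<mu> (pre_level r sbar T W \<mu> s k \<omega>) (W k \<omega>))) \<partial>M)"

definition value_function :: "'a measure \<Rightarrow> real \<Rightarrow> real \<Rightarrow> real \<Rightarrow> real \<Rightarrow> (nat \<Rightarrow> 'a \<Rightarrow> real) \<Rightarrow>
    (nat \<Rightarrow> 'a \<Rightarrow> real) \<Rightarrow> (real \<Rightarrow> real) \<Rightarrow> real \<Rightarrow> real" where
  "value_function M r \<theta> sbar B T W g s =
    (INF \<mu>\<in>policies sbar B. policy_cost M r \<theta> sbar T W g \<mu> s)"

definition myopic :: "real \<Rightarrow> real \<Rightarrow> real" where
  "myopic s w = min s w"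

end

theory Submission
  imports Defs
begin

text \<open>
  The myopic policy is optimal along every single path of arrivals and shocks; randomness matters
  only for passing to expectations.

  Run an arbitrary policy and the myopic policy from the same level on the same path. The myopic
  policy discharges at least as much in total up to every arrival. To see this, compare two leads:
  the lead that the other policy has in stored level and the lead that the myopic policy has in
  cumulative discharge. A discharge changes both by the same amount, and recharging up to the cap
  only moves the difference of the levels towards zero. So the lead in level never exceeds the lead
  in discharge as long as the latter is nonnegative. It stays nonnegative: either the myopic policy
  covers the whole shock, more than which nobody may discharge, or it empties its storage. In the
  latter case the other policy, limited by its own level, discharges at most the lead in level more,
  which the lead in discharge accumulated so far makes up for. This is
  \<open>level_lead_le_discharge_lead\<close>.

  With linear stage cost a path costs a policy-independent amount minus a multiple of the discounted
  discharge, and the discount factors decrease along the arrivals. Early discharge is thus worth most, and by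
  summation by parts (\<open>weighted_sum_nonneg\<close>) domination of the cumulative discharges gives domination
  of the discounted ones, first for finitely many arrivals and then in the limit.

  To take the limit and the expectation, the discounted series has to converge almost surely and
  its sum has to be integrable. By independence of the interarrival times the expected discount
  factor decays geometrically in the index of the arrival (\<open>expectation_discount\<close>), and an uncovered
  shock never exceeds \<open>B\<close>.
\<close>

section \<open>Summation by parts\<close>

text \<open>
  Summation by parts writes the weighted sum as a combination of the partial sums of \<open>a\<close> with
  coefficients \<open>c k - c (Suc k)\<close>, plus a boundary term. The induction below drops the
  nonnegative summands with these coefficients one at a time and keeps the boundary term as a lower
  bound.
\<close>

lemma weighted_sum_nonneg:
  fixes c a :: "nat \<Rightarrow> real"
  assumes "\<And>k. 0 \<le> c k" and "decseq c" and "\<And>n. 0 \<le> (\<Sum>k<n. a k)"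
  shows "0 \<le> (\<Sum>k<n. c k * a k)"
proof -
  have "c n * (\<Sum>k<n. a k) \<le> (\<Sum>k<n. c k * a k)" for n
  proof (induction n)
    case 0
    show ?case by simp
  next
    case (Suc n)
    have "c (Suc n) * (\<Sum>k<Suc n. a k) \<le> c n * (\<Sum>k<Suc n. a k)"
      by (rule mult_right_mono) (rule decseq_SucD[OF assms(2)] assms(3))+
    also have "\<dots> \<le> (\<Sum>k<Suc n. c k * a k)"
      using Suc.IH by (simp add: distrib_left)
    finally show ?case .
  qed
  moreover have "0 \<le> c n * (\<Sum>k<n. a k)"
    using assms by simp
  ultimately show ?thesis
    by (rule order_trans[rotated])
qed

section \<open>Policies and storage levels\<close>

lemma myopic_in_policies: "myopic \<in> policies sbar B"
proof -
  have "(\<lambda>(s, w). myopic s w) \<in> borel_measurable borel"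
    unfolding myopic_def by (simp add: borel_prod[symmetric] case_prod_unfold)
  then have "(\<lambda>(s, w). myopic s w) \<in> borel_measurable (restrict_space borel ({0..sbar} \<times> {0..B}))"
    by (rule measurable_restrict_space1)
  then show ?thesis
    by (simp add: policies_def) (simp add: myopic_def)
qed

lemma policy_bounds:
  assumes "\<mu> \<in> policies sbar B" "s \<in> {0..sbar}" "w \<in> {0..B}"
  shows "0 \<le> \<mu> s w" "\<mu> s w \<le> s" "\<mu> s w \<le> w"
  using assms by (auto simp: policies_def)

context storage_model
begin

lemma arrival_eq_sum_interarrival: "T k \<omega> = (\<Sum>i\<le>k. interarrival T i \<omega>)"
  by (induction k) auto

lemma measurable_interarrival [measurable]: "interarrival T k \<in> borel_measurable M"
  using distributed_measurable[OF interarrivals_exponential[of k]] by simp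

lemma measurable_arrival [measurable]: "T k \<in> borel_measurable M"
proof -
  have "T k = (\<lambda>\<omega>. \<Sum>i\<le>k. interarrival T i \<omega>)"
    by (rule ext) (rule arrival_eq_sum_interarrival)
  moreover have "\<dots> \<in> borel_measurable M"
    by measurable
  ultimately show ?thesis
    by simp
qed

lemma measurable_shock [measurable]: "W k \<in> borel_measurable M"
  using shocks_indep by (simp add: indep_vars_def)

lemma pre_level_range:
  assumes "\<omega> \<in> space M" "\<mu> \<in> policies sbar B" "s \<in> {0..sbar}"
  shows "pre_level r sbar T W \<mu> s k \<omega> \<in> {0..sbar}"
proof (induction k)
  case 0
  show ?case
    using assms sbar_pos r_pos first_arrival_pos[OF assms(1)] by auto
next
  case (Suc k)
  show ?case
    using policy_bounds(2)[OF assms(2) Suc.IH shocks_range[OF assms(1), of k]]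
      sbar_pos r_pos arrivals_increasing[OF assms(1), of k] by auto
qed

text \<open>
  A policy is measurable only as a function on its domain rectangle, so measurability of the
  discharge depends on the level \<open>L\<close> and the shock staying in that rectangle.
\<close>

lemma measurable_discharge:
  assumes "\<mu> \<in> policies sbar B" and [measurable]: "L \<in> borel_measurable M"
    and "\<And>\<omega>. \<omega> \<in> space M \<Longrightarrow> L \<omega> \<in> {0..sbar}"
  shows "(\<lambda>\<omega>. \<mu> (L \<omega>) (W k \<omega>)) \<in> borel_measurable M"
proof -
  have "(\<lambda>\<omega>. (L \<omega>, W k \<omega>)) \<in> M \<rightarrow>\<^sub>M restrict_space borel ({0..sbar} \<times> {0..B})"
    using assms(3) shocks_range
    by (intro measurable_restrict_space2) (auto simp: borel_prod[symmetric])
  moreover have "(\<lambda>(s, w). \<mu> s w) \<in> borel_measurable (restrict_space borel ({0..sbar} \<times> {0..B}))"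
    using assms(1) by (simp add: policies_def)
  ultimately show ?thesis
    by (auto dest: measurable_compose)
qed

lemma measurable_pre_level:
  assumes "\<mu> \<in> policies sbar B" "s \<in> {0..sbar}"
  shows "pre_level r sbar T W \<mu> s k \<in> borel_measurable M"
proof (induction k)
  case 0
  show ?case by (simp cong: measurable_cong)
next
  case (Suc k)
  note [measurable] = Suc.IH
    measurable_discharge[OF assms(1) Suc.IH pre_level_range[OF _ assms], of k]
  show ?case by simp
qed

section \<open>Pathwise domination\<close>

text \<open>
  The conclusion bounds two quantities at once because neither bound propagates alone. The lead in
  level before the next arrival is bounded with the help of the nonnegative lead in cumulative
  discharge, since the cap can raise a negative lead in level to zero. The lead in cumulative
  discharge stays nonnegative because of the bound on the lead in level, in the case that the
  myopic policy empties the storage.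
\<close>

lemma level_lead_le_discharge_lead:
  assumes "\<omega> \<in> space M" "\<mu> \<in> policies sbar B" "s \<in> {0..sbar}"
  defines "L \<equiv> \<lambda>\<mu> k. pre_level r sbar T W \<mu> s k \<omega>"
  shows "max 0 (L \<mu> n - L myopic n)
    \<le> (\<Sum>k<n. myopic (L myopic k) (W k \<omega>) - \<mu> (L \<mu> k) (W k \<omega>))"
proof (induction n)
  case 0
  show ?case by (simp add: L_def)
next
  case (Suc n)
  define x where "x = r * interarrival T (Suc n) \<omega>"
  have step: "L \<nu> (Suc n) = min sbar (L \<nu> n - \<nu> (L \<nu> n) (W n \<omega>) + x)" for \<nu>
    by (simp add: L_def x_def)
  have "L \<mu> n \<in> {0..sbar}"
    using assms pre_level_range by (simp add: L_def)
  note \<mu> = policy_bounds[OF assms(2) this shocks_range[OF assms(1), of n]]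
  define D where "D = (\<Sum>k<n. myopic (L myopic k) (W k \<omega>) - \<mu> (L \<mu> k) (W k \<omega>))"
  define u where "u = \<mu> (L \<mu> n) (W n \<omega>)"
  define v where "v = myopic (L myopic n) (W n \<omega>)"
  have v: "v = min (L myopic n) (W n \<omega>)"
    by (simp only: v_def myopic_def)
  have IH: "0 \<le> D" "L \<mu> n - L myopic n \<le> D"
    using Suc.IH by (simp_all add: D_def)
  \<comment> \<open>If the myopic policy covers the shock then \<open>v\<close> is the whole shock and \<open>u \<le> v\<close>; otherwise
     \<open>v\<close> is its whole level, and \<open>u\<close> is at most the other level.\<close>
  have "0 \<le> D + (v - u)"
    using IH \<mu> unfolding u_def[symmetric] v by linarith
  \<comment> \<open>Immediately after the discharge both leads have changed by the same amount \<open>v - u\<close>. Recharging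
     up to the cap then shrinks the lead in level towards zero, which the last step uses.\<close>
  moreover have "(L \<mu> n - u) - (L myopic n - v) \<le> D + (v - u)"
    using IH by simp
  ultimately show ?case
    unfolding step sum.lessThan_Suc D_def[symmetric] u_def[symmetric] v_def[symmetric] by linarith
qed


lemma discount_sums_le:
  assumes "\<omega> \<in> space M" "\<mu> \<in> policies sbar B" "s \<in> {0..sbar}"
  defines "L \<equiv> \<lambda>\<mu> k. pre_level r sbar T W \<mu> s k \<omega>"
  shows "(\<Sum>k<n. exp (- \<theta> * T k \<omega>) * (W k \<omega> - myopic (L myopic k) (W k \<omega>)))
    \<le> (\<Sum>k<n. exp (- \<theta> * T k \<omega>) * (W k \<omega> - \<mu> (L \<mu> k) (W k \<omega>)))"
proof -
  have "0 \<le> (\<Sum>k<n. exp (- \<theta> * T k \<omega>) *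
      (myopic (L myopic k) (W k \<omega>) - \<mu> (L \<mu> k) (W k \<omega>)))"
  proof (rule weighted_sum_nonneg)
    show "decseq (\<lambda>k. exp (- \<theta> * T k \<omega>))"
      using arrivals_increasing[OF assms(1)] theta_pos
      by (auto intro!: decseq_SucI less_imp_le)
    show "0 \<le> (\<Sum>k<n. myopic (L myopic k) (W k \<omega>) - \<mu> (L \<mu> k) (W k \<omega>))" for n
      using level_lead_le_discharge_lead[OF assms(1-3), of n] by (simp add: L_def)
  qed simp
  then show ?thesis
    by (simp add: right_diff_distrib sum_subtractf)
qed

section \<open>Discounting at the arrival times\<close>

lemma discount_ratio: "0 \<le> Q / (Q + \<theta>)" "Q / (Q + \<theta>) < 1"
  using Q_pos theta_pos by auto

text \<open>
  This is the Laplace transform of the exponential distribution at \<open>\<theta>\<close>: discounting tilts the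
  density with rate \<open>Q\<close> to the one with rate \<open>Q + \<theta>\<close>, up to the ratio of the rates.
\<close>

lemma nn_integral_discount_interarrival:
  "(\<integral>\<^sup>+\<omega>. ennreal (exp (- \<theta> * interarrival T k \<omega>)) \<partial>M) = ennreal (Q / (Q + \<theta>))"
proof -
  have pos: "0 < Q + \<theta>"
    using Q_pos theta_pos by simp
  have "(\<integral>\<^sup>+\<omega>. ennreal (exp (- \<theta> * interarrival T k \<omega>)) \<partial>M)
      = (\<integral>\<^sup>+x. ennreal (exponential_density Q x) * ennreal (exp (- \<theta> * x)) \<partial>lborel)"
    by (rule distributed_nn_integral[OF interarrivals_exponential, symmetric]) simp
  also have "\<dots> = (\<integral>\<^sup>+x. ennreal (Q / (Q + \<theta>)) * ennreal (exponential_density (Q + \<theta>) x) \<partial>lborel)"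
  proof (rule nn_integral_cong)
    fix x
    have "exponential_density Q x * exp (- \<theta> * x) = Q / (Q + \<theta>) * exponential_density (Q + \<theta>) x"
    proof -
      have "exp (- x * (Q + \<theta>)) = exp (- x * Q) * exp (- \<theta> * x)"
        by (simp add: exp_add[symmetric] algebra_simps)
      then show ?thesis
        using pos by (simp add: exponential_density_def)
    qed
    then show "ennreal (exponential_density Q x) * ennreal (exp (- \<theta> * x))
        = ennreal (Q / (Q + \<theta>)) * ennreal (exponential_density (Q + \<theta>) x)"
      using Q_pos pos by (simp add: ennreal_mult'[symmetric] ennreal_mult''[symmetric])
  qed
  also have "\<dots> = ennreal (Q / (Q + \<theta>)) * (\<integral>\<^sup>+x. ennreal (exponential_density (Q + \<theta>) x) \<partial>lborel)"
    by (rule nn_integral_cmult) simp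
  also have "(\<integral>\<^sup>+x. ennreal (exponential_density (Q + \<theta>) x) \<partial>lborel) = 1"
    using prob_space.emeasure_space_1[OF prob_space_exponential_density[OF pos]]
    by (simp add: emeasure_density)
  finally show ?thesis
    by simp
qed

lemma nn_integral_discount:
  "(\<integral>\<^sup>+\<omega>. ennreal (exp (- \<theta> * T k \<omega>)) \<partial>M) = ennreal ((Q / (Q + \<theta>)) ^ Suc k)"
proof -
  have "(\<integral>\<^sup>+\<omega>. ennreal (exp (- \<theta> * T k \<omega>)) \<partial>M)
      = (\<integral>\<^sup>+\<omega>. (\<Prod>i\<le>k. ennreal (exp (- \<theta> * interarrival T i \<omega>))) \<partial>M)"
    by (intro nn_integral_cong)
      (simp only: arrival_eq_sum_interarrival[of k] sum_distrib_left exp_sum finite_atMost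
        prod_ennreal exp_ge_zero)
  also have "\<dots> = (\<Prod>i\<le>k. \<integral>\<^sup>+\<omega>. ennreal (exp (- \<theta> * interarrival T i \<omega>)) \<partial>M)"
  proof (rule indep_vars_nn_integral)
    show "indep_vars (\<lambda>_. borel) (\<lambda>i \<omega>. ennreal (exp (- \<theta> * interarrival T i \<omega>))) {..k}"
      by (rule indep_vars_compose2[OF indep_vars_subset[OF interarrivals_indep]]) auto
  qed auto
  also have "\<dots> = ennreal ((Q / (Q + \<theta>)) ^ Suc k)"
    by (simp only: nn_integral_discount_interarrival prod_constant card_atMost
        ennreal_power discount_ratio(1))
  finally show ?thesis .
qed

lemma integrable_discount: "integrable M (\<lambda>\<omega>. exp (- \<theta> * T k \<omega>))"
  and expectation_discount: "expectation (\<lambda>\<omega>. exp (- \<theta> * T k \<omega>)) = (Q / (Q + \<theta>)) ^ Suc k"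
proof -
  have "has_bochner_integral M (\<lambda>\<omega>. exp (- \<theta> * T k \<omega>)) ((Q / (Q + \<theta>)) ^ Suc k)"
    using nn_integral_discount zero_le_power[OF discount_ratio(1)]
    by (intro has_bochner_integral_nn_integral) (auto simp del: power_Suc)
  then show "integrable M (\<lambda>\<omega>. exp (- \<theta> * T k \<omega>))"
    and "expectation (\<lambda>\<omega>. exp (- \<theta> * T k \<omega>)) = (Q / (Q + \<theta>)) ^ Suc k"
    by (auto simp: has_bochner_integral_iff)
qed

lemma summable_expected_discount: "summable (\<lambda>k. (Q / (Q + \<theta>)) ^ Suc k)"
proof -
  have "norm (Q / (Q + \<theta>)) < 1"
    using discount_ratio by (simp only: real_norm_def abs_of_nonneg)
  then show ?thesis
    by (subst summable_Suc_iff) (rule summable_geometric)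
qed

text \<open>
  Almost surely the arrival times grow fast enough for the discount factors to be summable, because
  the expectation of their sum is a convergent geometric series. On the exceptional null set
  arrivals may accumulate and the series may diverge.
\<close>

lemma AE_summable_discount: "AE \<omega> in M. summable (\<lambda>k. exp (- \<theta> * T k \<omega>))"
proof -
  have "(\<integral>\<^sup>+\<omega>. (\<Sum>k. ennreal (exp (- \<theta> * T k \<omega>))) \<partial>M)
      = (\<Sum>k. \<integral>\<^sup>+\<omega>. ennreal (exp (- \<theta> * T k \<omega>)) \<partial>M)"
    by (rule nn_integral_suminf) simp
  also have "\<dots> = (\<Sum>k. ennreal ((Q / (Q + \<theta>)) ^ Suc k))"
    by (simp only: nn_integral_discount)
  also have "\<dots> \<noteq> \<infinity>"
    using zero_le_power[OF discount_ratio(1)] summable_expected_discount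
    by (simp add: ennreal_suminf_neq_top del: power_Suc)
  finally have "AE \<omega> in M. (\<Sum>k. ennreal (exp (- \<theta> * T k \<omega>))) \<noteq> \<infinity>"
    by (intro nn_integral_noteq_infinite) auto
  then show ?thesis
    by eventually_elim (auto intro!: summable_suminf_not_top)
qed

section \<open>Expected costs\<close>

text \<open>
  Both facts follow by domination: an uncovered shock lies between \<open>0\<close> and \<open>B\<close>, so the series is
  bounded termwise by \<open>B\<close> times the discount factors, and likewise in expectation. Integrability
  matters since otherwise the Bochner integral that defines the cost would have the value zero and
  the pathwise comparison could not be integrated.
\<close>

lemma
  assumes "\<mu> \<in> policies sbar B" "s \<in> {0..sbar}"
  defines "c \<equiv> \<lambda>k \<omega>. exp (- \<theta> * T k \<omega>) * (W k \<omega> - \<mu> (pre_level r sbar T W \<mu> s k \<omega>) (W k \<omega>))"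
  shows integrable_discounted_shortfall: "integrable M (\<lambda>\<omega>. \<Sum>k. c k \<omega>)"
    and AE_summable_discounted_shortfall: "AE \<omega> in M. summable (\<lambda>k. c k \<omega>)"
proof -
  have bound: "norm (c k \<omega>) \<le> B * exp (- \<theta> * T k \<omega>)" if "\<omega> \<in> space M" for k \<omega>
    using policy_bounds[OF assms(1) pre_level_range[OF that assms(1,2), of k]
        shocks_range[OF that, of k]] shocks_range[OF that, of k]
    by (auto simp: c_def abs_mult mult.commute intro!: mult_left_mono)
  have [measurable]: "c k \<in> borel_measurable M" for k
  proof -
    note [measurable] = measurable_discharge[OF assms(1) measurable_pre_level[OF assms(1,2)]
        pre_level_range[OF _ assms(1,2)], of k k]
    show ?thesis
      unfolding c_def by measurable
  qed
  have int: "integrable M (c k)" for k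
    by (rule Bochner_Integration.integrable_bound[of _ "\<lambda>\<omega>. B * exp (- \<theta> * T k \<omega>)"])
      (use integrable_discount bound B_pos in \<open>auto simp: abs_mult\<close>)
  have summ: "AE \<omega> in M. summable (\<lambda>k. norm (c k \<omega>))"
    using AE_summable_discount AE_space
  proof eventually_elim
    case (elim \<omega>)
    show ?case
      by (rule summable_comparison_test'[OF summable_mult[OF elim(1), of B], of 0])
        (simp add: bound[OF elim(2), simplified])
  qed
  have "(\<integral>\<omega>. norm (c k \<omega>) \<partial>M) \<le> B * (Q / (Q + \<theta>)) ^ Suc k" for k
  proof -
    have "(\<integral>\<omega>. norm (c k \<omega>) \<partial>M) \<le> (\<integral>\<omega>. B * exp (- \<theta> * T k \<omega>) \<partial>M)"
      using int integrable_discount bound by (intro integral_mono) auto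
    then show ?thesis
      by (simp only: integral_mult_right_zero expectation_discount)
  qed
  then have "summable (\<lambda>k. \<integral>\<omega>. norm (c k \<omega>) \<partial>M)"
    by (intro summable_comparison_test'[OF summable_mult[OF summable_expected_discount, of B], of 0])
      (simp del: power_Suc)
  with int summ show "integrable M (\<lambda>\<omega>. \<Sum>k. c k \<omega>)"
    by (rule integrable_suminf)
  show "AE \<omega> in M. summable (\<lambda>k. c k \<omega>)"
    using summ by eventually_elim (rule summable_norm_cancel)
qed

text \<open>
  With the identity as stage cost, the cost of a policy is the expected discounted amount of shocks
  that it leaves uncovered, so the pathwise comparison can be integrated directly.
\<close>

lemma myopic_discounted_shortfall_le:
  assumes "\<mu> \<in> policies sbar B" "s \<in> {0..sbar}"
  shows "policy_cost M r \<theta> sbar T W (\<lambda>x. x) myopic s \<le> policy_cost M r \<theta> sbar T W (\<lambda>x. x) \<mu> s"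
  unfolding policy_cost_def
proof (rule integral_mono_AE[OF integrable_discounted_shortfall[OF myopic_in_policies assms(2)]
      integrable_discounted_shortfall[OF assms]])
  show "AE \<omega> in M.
      (\<Sum>k. exp (- \<theta> * T k \<omega>) * (W k \<omega> - myopic (pre_level r sbar T W myopic s k \<omega>) (W k \<omega>)))
      \<le> (\<Sum>k. exp (- \<theta> * T k \<omega>) * (W k \<omega> - \<mu> (pre_level r sbar T W \<mu> s k \<omega>) (W k \<omega>)))"
    using AE_summable_discounted_shortfall[OF myopic_in_policies assms(2)]
      AE_summable_discounted_shortfall[OF assms] AE_space
  proof eventually_elim
    case (elim \<omega>)
    show ?case
      using LIMSEQ_le[OF summable_LIMSEQ[OF elim(1)] summable_LIMSEQ[OF elim(2)]]
        discount_sums_le[OF elim(3) assms] by blast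
  qed
qed

text \<open>
  Linearity of \<open>g\<close> is available only on \<open>{0..B}\<close>, but uncovered shocks never leave that interval.
\<close>

lemma policy_cost_linear:
  assumes "\<forall>x\<in>{0..B}. g x = \<beta> * x" "\<mu> \<in> policies sbar B" "s \<in> {0..sbar}"
  shows "policy_cost M r \<theta> sbar T W g \<mu> s = \<beta> * policy_cost M r \<theta> sbar T W (\<lambda>x. x) \<mu> s"
proof -
  let ?u = "\<lambda>k \<omega>. W k \<omega> - \<mu> (pre_level r sbar T W \<mu> s k \<omega>) (W k \<omega>)"
  have "g (?u k \<omega>) = \<beta> * ?u k \<omega>" if "\<omega> \<in> space M" for k \<omega>
    using policy_bounds[OF assms(2) pre_level_range[OF that assms(2,3), of k]
        shocks_range[OF that, of k]] shocks_range[OF that, of k]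
    by (intro bspec[OF assms(1)]) auto
  then have "policy_cost M r \<theta> sbar T W g \<mu> s
      = (\<integral>\<omega>. (\<Sum>k. \<beta> * (exp (- \<theta> * T k \<omega>) * ?u k \<omega>)) \<partial>M)"
    unfolding policy_cost_def
    by (intro Bochner_Integration.integral_cong) (simp_all only: mult.left_commute)
  also have "\<dots> = (\<integral>\<omega>. \<beta> * (\<Sum>k. exp (- \<theta> * T k \<omega>) * ?u k \<omega>) \<partial>M)"
  proof (rule integral_cong_AE)
    show "AE \<omega> in M. (\<Sum>k. \<beta> * (exp (- \<theta> * T k \<omega>) * ?u k \<omega>))
        = \<beta> * (\<Sum>k. exp (- \<theta> * T k \<omega>) * ?u k \<omega>)"
      using AE_summable_discounted_shortfall[OF assms(2,3)]
      by eventually_elim (rule suminf_mult)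
    note [measurable] = measurable_discharge[OF assms(2) measurable_pre_level[OF assms(2,3)]
        pre_level_range[OF _ assms(2,3)]]
    show "(\<lambda>\<omega>. \<Sum>k. \<beta> * (exp (- \<theta> * T k \<omega>) * ?u k \<omega>)) \<in> borel_measurable M"
      by measurable
    show "(\<lambda>\<omega>. \<beta> * (\<Sum>k. exp (- \<theta> * T k \<omega>) * ?u k \<omega>)) \<in> borel_measurable M"
      by measurable
  qed
  also have "\<dots> = \<beta> * policy_cost M r \<theta> sbar T W (\<lambda>x. x) \<mu> s"
    unfolding policy_cost_def by (rule integral_mult_right_zero)
  finally show ?thesis .
qed

end

theorem theorem3:
  fixes M :: "'a measure"
    and r Q \<theta> sbar B \<beta> :: real
    and fW :: "real measure"
    and T W :: "nat \<Rightarrow> 'a \<Rightarrow> real"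
    and g :: "real \<Rightarrow> real"
  assumes "storage_model M r Q \<theta> sbar B fW T W g"
    and "\<beta> > 0"
    and "\<forall>x\<in>{0..B}. g x = \<beta> * x"
  shows "myopic \<in> policies sbar B \<and>
    (\<forall>s\<in>{0..sbar}.
      policy_cost M r \<theta> sbar T W g myopic s = value_function M r \<theta> sbar B T W g s \<and>
      (\<forall>\<mu>\<in>policies sbar B.
        policy_cost M r \<theta> sbar T W g myopic s \<le> policy_cost M r \<theta> sbar T W g \<mu> s))"
proof (intro conjI ballI)
  interpret storage_model M r Q \<theta> sbar B fW T W g
    by (rule assms(1))
  show in_policies: "myopic \<in> policies sbar B"
    by (rule myopic_in_policies)
  fix s assume s: "s \<in> {0..sbar}"
  show minimal: "policy_cost M r \<theta> sbar T W g myopic s \<le> policy_cost M r \<theta> sbar T W g \<mu> s"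
    if "\<mu> \<in> policies sbar B" for \<mu>
    using myopic_discounted_shortfall_le[OF that s] assms(2)
    by (simp add: policy_cost_linear[OF assms(3) that s] policy_cost_linear[OF assms(3) in_policies s])
  show "policy_cost M r \<theta> sbar T W g myopic s = value_function M r \<theta> sbar B T W g s"
    unfolding value_function_def
    using in_policies minimal by (intro cInf_eq_minimum[symmetric]) auto
qed

end
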